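(* Let $M$ and $N$ be positive integers, and let $a_m$ be the coefficients of the polynomial $$1-T_{N-1}(t)\,T_{M-1}(-t)=\sum_{m=1}^{M+N-2}a_m t^m.$$ Then for every integer $n\ge 0$: (1) for all $x$, $$\sum_{m=1}^{M+N-2}m!\,a_m\sum_{k=0}^{n-m}(-1)^k\binom{n}{m;k}B_{N,n-m-k}(x)\,B_{M,k}(x)$$ $$=(-1)^M\binom{M+N}{M}\delta_{n-M-N}+(-1)^M\sum_{m=0}^{N-1}\binom{n}{m;M}B_{N,n-m-M}+(-1)^{n-N}\sum_{m=0}^{M-1}\binom{n}{m;N}B_{M,n-m-N};$$ (2) if $N\ge M$, then for all $x_1,x_2$, with $x=x_1+x_2$, $$\sum_{m=M}^{N-1}\sum_{k=0}^{n-m}\binom{n}{m;k}B_{N,n-m-k}(x_1)\,B_{M,k}(x_2)=\binom{n}{M}B_{N,n-M}(x)-\binom{n}{N}B_{M,n-N}(x).$$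
   Context: $T_{N}(t)=\sum_{m=0}^{N}\frac{t^m}{m!}$ is the $N$-th Taylor polynomial of $e^t$. For a positive integer $N$, the hypergeometric Bernoulli polynomials $B_{N,n}(x)$ of order $N$ are defined by $$\frac{(t^N/N!)\,e^{xt}}{e^t-T_{N-1}(t)}=\sum_{n=0}^\infty B_{N,n}(x)\frac{t^n}{n!}.$$ The hypergeometric Bernoulli numbers are $B_{N,n}=B_{N,n}(0)$, and $B_{N,n}(x)=0$ (so $B_{N,n}=0$) for $n<0$. $\delta_m$ equals $1$ if $m=0$ and $0$ otherwise. The multinomial coefficient is $\binom{a}{b;c}=\frac{a!}{b!\,c!\,(a-b-c)!}$; any term containing a $B$ with negative second index is $0$, and sums over empty ranges are $0$. *)

theory Defs
  imports "HOL-Computational_Algebra.Computational_Algebra"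
begin

definition exp_taylor :: "nat \<Rightarrow> 'a::field_char_0 poly" where
  "exp_taylor N = (\<Sum>m=0..N. monom (1 / fact m) m)"

text \<open>The second index is an integer so that the convention \<open>B\<^sub>N\<^sub>,\<^sub>n(x) = 0\<close> for
  \<open>n < 0\<close> can be expressed. For \<open>N > 0\<close> the quotient of power series is exact, since the denominator
  has order \<open>N\<close> (see \<open>hyp_bernpoly_generating_function\<close>); the value at \<open>N = 0\<close> has no meaning.\<close>

definition hyp_bernpoly :: "nat \<Rightarrow> int \<Rightarrow> 'a::field_char_0 \<Rightarrow> 'a" where
  "hyp_bernpoly N n x =
     (if n < 0 then 0
      else fact (nat n) *
        fps_nth (fps_const (1 / fact N) * fps_X ^ N * fps_exp x /
                 (fps_exp 1 - fps_of_poly (exp_taylor (N - 1)))) (nat n))"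

definition hyp_bernum :: "nat \<Rightarrow> int \<Rightarrow> 'a::field_char_0" where
  "hyp_bernum N n = hyp_bernpoly N n 0"

definition delta :: "int \<Rightarrow> 'a::field_char_0" where
  "delta m = (if m = 0 then 1 else 0)"

text \<open>Only meaningful for \<open>b + c \<le> a\<close>, because the subtraction truncates.\<close>

definition multinom :: "nat \<Rightarrow> nat \<Rightarrow> nat \<Rightarrow> 'a::field_char_0" where
  "multinom a b c = fact a / (fact b * fact c * fact (a - b - c))"

text \<open>The composition with \<open>[:0, -1:]\<close> is the substitution of \<open>-t\<close> for \<open>t\<close>.\<close>

definition taylor_prod_coeff :: "nat \<Rightarrow> nat \<Rightarrow> nat \<Rightarrow> 'a::field_char_0" where
  "taylor_prod_coeff M N m =
     coeff (1 - exp_taylor (N - 1) * pcompose (exp_taylor (M - 1)) [:0, -1:]) m"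

lemma coeff_exp_taylor: "coeff (exp_taylor N) m = (if m \<le> N then 1 / fact m else 0)"
  by (simp add: exp_taylor_def coeff_sum)

lemma poly_exp_taylor_0: "poly (exp_taylor N) 0 = 1"
  by (subst poly_0_coeff_0) (subst coeff_exp_taylor, simp)

lemma degree_exp_taylor: "degree (exp_taylor N) \<le> N"
  by (rule degree_le) (simp add: coeff_exp_taylor)

lemma taylor_prod_expansion:
  assumes "M > 0" "N > 0"
  shows "1 - exp_taylor (N - 1) * pcompose (exp_taylor (M - 1)) [:0, -1:]
         = (\<Sum>m=1..M+N-2. monom (taylor_prod_coeff M N m :: 'a::field_char_0) m)"
    (is "?p = _")
proof -
  have "degree (exp_taylor (N - 1) * pcompose (exp_taylor (M - 1)) [:0, -1::'a:])
        \<le> (N - 1) + (M - 1) * 1"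
    by (intro order.trans[OF degree_mult_le] add_mono degree_exp_taylor
          order.trans[OF degree_pcompose_le] mult_mono) auto
  hence "degree ?p \<le> M + N - 2"
    using assms by (intro degree_diff_le) auto
  hence "?p = (\<Sum>m\<le>M+N-2. monom (coeff ?p m) m)"
    by (rule poly_as_sum_of_monoms'[symmetric])
  also have "{..M+N-2} = insert 0 {1..M+N-2}" by auto
  also have "(\<Sum>m\<in>\<dots>. monom (coeff ?p m) m) = (\<Sum>m=1..M+N-2. monom (coeff ?p m) m)"
    by (subst sum.insert) (auto simp: coeff_mult_0 coeff_exp_taylor poly_exp_taylor_0)
  finally show ?thesis unfolding taylor_prod_coeff_def .
qed

lemma subdegree_exp_minus_taylor:
  assumes "N > 0"
  shows "subdegree (fps_exp 1 - fps_of_poly (exp_taylor (N - 1)) :: 'a::field_char_0 fps) = N"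
  using assms by (intro subdegreeI) (auto simp: coeff_exp_taylor)

lemma hyp_bernpoly_generating_function:
  fixes x :: "'a::field_char_0"
  assumes "N > 0"
  shows "(fps_exp 1 - fps_of_poly (exp_taylor (N - 1))) *
           Abs_fps (\<lambda>n. hyp_bernpoly N (int n) x / fact n)
         = fps_const (1 / fact N) * fps_X ^ N * fps_exp x"
proof -
  let ?d = "fps_exp 1 - fps_of_poly (exp_taylor (N - 1)) :: 'a fps"
  let ?f = "fps_const (1 / fact N) * fps_X ^ N * fps_exp x"
  have sd: "subdegree ?d = N" by (rule subdegree_exp_minus_taylor[OF assms])
  have "Abs_fps (\<lambda>n. hyp_bernpoly N (int n) x / fact n) = ?f / ?d"
    by (rule fps_ext) (simp add: hyp_bernpoly_def)
  moreover have "?d dvd ?f"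
  proof (subst fps_dvd_iff)
    show "?d \<noteq> 0" using sd assms by auto
    show "?f \<noteq> 0" by auto
    show "subdegree ?d \<le> subdegree ?f" unfolding sd
      by (auto simp: subdegree_mult)
  qed
  ultimately show ?thesis by simp
qed

lemma hyp_bernpoly_is_polynomial:
  assumes "N > 0"
  shows "hyp_bernpoly N (int n) (x :: 'a::field_char_0)
         = (\<Sum>k\<le>n. of_nat (n choose k) * hyp_bernum N (int k) * x ^ (n - k))"
proof -
  let ?d = "fps_exp 1 - fps_of_poly (exp_taylor (N - 1)) :: 'a fps"
  let ?B = "\<lambda>x. Abs_fps (\<lambda>n. hyp_bernpoly N (int n) x / fact n) :: 'a fps"
  note gf = hyp_bernpoly_generating_function[OF assms]
  have "?d * (?B 0 * fps_exp x) = (?d * ?B 0) * fps_exp x"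
    by (rule mult.assoc[symmetric])
  also have "\<dots> = fps_const (1 / fact N) * fps_X ^ N * fps_exp 0 * fps_exp x"
    by (subst gf) (rule refl)
  also have "\<dots> = ?d * ?B x"
    by (subst gf) simp
  finally have "?d * ?B x = ?d * (?B 0 * fps_exp x)" by (rule sym)
  moreover have "?d \<noteq> 0"
    using subdegree_exp_minus_taylor[OF assms, where 'a='a] assms by auto
  ultimately have "?B x = ?B 0 * fps_exp x" by (rule mult_left_cancel[THEN iffD1, rotated])
  hence "fps_nth (?B x) n = fps_nth (?B 0 * fps_exp x) n" by (rule arg_cong)
  hence "hyp_bernpoly N (int n) x / fact n =
         (\<Sum>k\<le>n. hyp_bernum N (int k) / fact k * (x ^ (n - k) / fact (n - k)))"
    unfolding fps_mult_nth by (simp add: atLeast0AtMost hyp_bernum_def)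
  hence "hyp_bernpoly N (int n) x =
         (\<Sum>k\<le>n. hyp_bernum N (int k) / fact k * (x ^ (n - k) / fact (n - k))) * fact n"
    by (simp add: divide_eq_eq)
  also have "\<dots> = (\<Sum>k\<le>n. of_nat (n choose k) * hyp_bernum N (int k) * x ^ (n - k))"
    unfolding sum_distrib_right
    by (intro sum.cong refl) (simp add: binomial_fact)
  finally show ?thesis .
qed

end

theory Submission
  imports Defs
begin

text \<open>
  Write \<open>D\<^sub>N = e\<^sup>t - T\<^sub>N\<^sub>-\<^sub>1(t)\<close> and let \<open>G\<^sub>N(x)\<close> be the exponential generating function of the
  polynomials \<open>B\<^sub>N\<^sub>,\<^sub>n(x)\<close>, so that \<open>D\<^sub>N G\<^sub>N(x) = t\<^sup>N e\<^sup>x\<^sup>t / N!\<close>. Both parts compare coefficients in an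
  identity of power series that is linear in the generating functions on one side and quadratic on
  the other; each of these identities becomes trivial after multiplication by two denominators.

  For the first part, the elementary identity
  \<open>a b - p q = (a - p) (b - q) + p (b - q) + q (a - p)\<close>
  with \<open>a = e\<^sup>t\<close>, \<open>b = e\<^sup>-\<^sup>t\<close>, \<open>p = T\<^sub>N\<^sub>-\<^sub>1(t)\<close>, \<open>q = T\<^sub>M\<^sub>-\<^sub>1(-t)\<close> expresses
  \<open>1 - T\<^sub>N\<^sub>-\<^sub>1(t) T\<^sub>M\<^sub>-\<^sub>1(-t)\<close> through \<open>D\<^sub>N(t)\<close> and \<open>D\<^sub>M(-t)\<close>. Multiplied by \<open>G\<^sub>N(x)(t) G\<^sub>M(x)(-t)\<close>, in
  which the exponentials cancel, the three summands give the delta term and the two linear sums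
  (\<open>bern_egf_product_reflected\<close>).

  For the second part, \<open>T\<^sub>N\<^sub>-\<^sub>1 - T\<^sub>M\<^sub>-\<^sub>1 = D\<^sub>M - D\<^sub>N\<close>, whose product with \<open>G\<^sub>N(x\<^sub>1) G\<^sub>M(x\<^sub>2)\<close> loses one
  denominator in each of its two terms, while the exponentials combine to \<open>e\<^sup>x\<^sup>t\<close>
  (\<open>bern_egf_product\<close>).
\<close>

section \<open>The exponential generating functions\<close>

text \<open>The degree is \<open>N - 1\<close>, so that the index is the order of the Bernoulli polynomials. Because
  subtraction truncates, \<open>N = 0\<close> gives the same series as \<open>N = 1\<close>, and the order of the exponential
  tail is \<open>N\<close> only for positive \<open>N\<close>.\<close>

definition taylor_fps :: "nat \<Rightarrow> 'a::field_char_0 fps" where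
  "taylor_fps N = fps_of_poly (exp_taylor (N - 1))"

definition exp_tail :: "nat \<Rightarrow> 'a::field_char_0 fps" where
  "exp_tail N = fps_exp 1 - taylor_fps N"

definition bern_egf :: "nat \<Rightarrow> 'a \<Rightarrow> 'a::field_char_0 fps" where
  "bern_egf N x = Abs_fps (\<lambda>n. hyp_bernpoly N (int n) x / fact n)"

text \<open>The substitution of \<open>-t\<close> for \<open>t\<close>; the inner series is written as a polynomial so that it
  agrees with the composition of polynomials that defines the coefficients \<open>a\<^sub>m\<close>.\<close>

definition fps_reflect :: "'a::field_char_0 fps \<Rightarrow> 'a fps" where
  "fps_reflect f = fps_compose f (fps_of_poly [:0, -1:])"

lemma exp_tail_nonzero:
  assumes "N > 0"
  shows "(exp_tail N :: 'a::field_char_0 fps) \<noteq> 0"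
  using subdegree_exp_minus_taylor[OF assms, where 'a='a] assms
  by (auto simp: exp_tail_def taylor_fps_def)

lemma exp_tail_times_bern_egf:
  assumes "N > 0"
  shows "exp_tail N * bern_egf N x = fps_const (1 / fact N) * fps_X ^ N * fps_exp x"
  using hyp_bernpoly_generating_function[OF assms, of x]
  by (simp add: exp_tail_def taylor_fps_def bern_egf_def)

lemma fps_reflect_nth: "fps_nth (fps_reflect f) n = (-1) ^ n * fps_nth f n"
proof -
  have "fps_of_poly [:0, -1:] = fps_const (-1 :: 'a) * fps_X"
    by (simp add: fps_of_poly_pCons)
  then show ?thesis
    unfolding fps_reflect_def by (simp only: fps_compose_linear fps_nth_Abs_fps)
qed

lemma fps_reflect_mult: "fps_reflect (f * g) = fps_reflect f * fps_reflect g"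
  unfolding fps_reflect_def by (rule fps_compose_mult_distrib) simp

lemma fps_reflect_diff: "fps_reflect (f - g) = fps_reflect f - fps_reflect g"
  by (simp add: fps_eq_iff fps_reflect_nth algebra_simps)

lemma fps_reflect_fps_exp: "fps_reflect (fps_exp x) = fps_exp (- x)"
  by (simp add: fps_eq_iff fps_reflect_nth power_minus[of x])

lemma fps_reflect_monomial:
  "fps_reflect (fps_const c * fps_X ^ N) = fps_const ((-1) ^ N * c) * fps_X ^ N"
  by (simp add: fps_eq_iff fps_reflect_nth)

lemma fps_reflect_eq_0_iff: "fps_reflect f = 0 \<longleftrightarrow> f = 0"
  by (simp add: fps_eq_iff fps_reflect_nth)

lemma taylor_product_expansion_fps:
  assumes "M > 0" "N > 0"
  shows "1 - taylor_fps N * fps_reflect (taylor_fps M :: 'a::field_char_0 fps) =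
    (\<Sum>m=1..M+N-2. fps_const (taylor_prod_coeff M N m) * fps_X ^ m)"
proof -
  have "fps_of_poly (1 - exp_taylor (N - 1) * pcompose (exp_taylor (M - 1)) [:0, -1 :: 'a:]) =
      1 - taylor_fps N * fps_reflect (taylor_fps M)"
    by (simp add: fps_of_poly_diff fps_of_poly_mult fps_of_poly_pcompose
        taylor_fps_def fps_reflect_def)
  then show ?thesis
    unfolding taylor_prod_expansion[OF assms] by (simp add: fps_of_poly_sum fps_of_poly_monom)
qed

lemma taylor_fps_expansion:
  "taylor_fps N = (\<Sum>m=0..N-1. fps_const (1 / fact m) * fps_X ^ m)"
  by (simp add: taylor_fps_def exp_taylor_def fps_of_poly_sum fps_of_poly_monom)

lemma fps_reflect_taylor_fps_expansion:
  "fps_reflect (taylor_fps N) = (\<Sum>m=0..N-1. fps_const ((-1) ^ m / fact m) * fps_X ^ m)"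
  by (simp add: fps_eq_iff fps_reflect_nth taylor_fps_expansion fps_sum_nth
      sum_distrib_left)
     (auto intro!: sum.cong)

section \<open>The two power series identities\<close>

text \<open>The product formula behind the first part: over the common denominator
  \<open>D\<^sub>N(t) D\<^sub>M(-t)\<close> it is the identity \<open>a b - p q = (a - p) (b - q) + p (b - q) + q (a - p)\<close> with
  \<open>a b = e\<^sup>t e\<^sup>-\<^sup>t = 1\<close>.\<close>

lemma bern_egf_product_reflected:
  fixes x :: "'a::field_char_0"
  assumes "M > 0" "N > 0"
  shows "(1 - taylor_fps N * fps_reflect (taylor_fps M)) * (bern_egf N x * fps_reflect (bern_egf M x)) =
    fps_const ((-1) ^ M / (fact N * fact M)) * fps_X ^ (M + N)
    + fps_const ((-1) ^ M / fact M) * fps_X ^ M * (taylor_fps N * bern_egf N 0)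
    + fps_const (1 / fact N) * fps_X ^ N * (fps_reflect (taylor_fps M) * fps_reflect (bern_egf M 0))"
    (is "?L = ?R")
proof -
  define p q :: "'a fps" where "p = taylor_fps N" and "q = fps_reflect (taylor_fps M)"
  define d e :: "'a fps" where "d = exp_tail N" and "e = fps_reflect (exp_tail M)"
  define u v :: "'a fps" where "u = fps_const (1 / fact N) * fps_X ^ N"
    and "v = fps_const ((-1) ^ M / fact M) * fps_X ^ M"
  have dN: "d * bern_egf N y = u * fps_exp y" for y
    unfolding d_def u_def by (rule exp_tail_times_bern_egf[OF assms(2)])
  have eM: "e * fps_reflect (bern_egf M y) = v * fps_exp (- y)" for y
  proof -
    have "e * fps_reflect (bern_egf M y) = fps_reflect (exp_tail M * bern_egf M y)"
      by (simp add: e_def fps_reflect_mult)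
    also have "\<dots> = v * fps_exp (- y)"
      unfolding exp_tail_times_bern_egf[OF assms(1)] fps_reflect_mult[of "_ * _" "fps_exp _"]
        fps_reflect_monomial fps_reflect_fps_exp v_def by simp
    finally show ?thesis .
  qed
  have inverse: "fps_exp y * fps_exp (- y) = 1" for y :: 'a
    by (simp add: fps_exp_add_mult[symmetric])
  have key: "1 - p * q = d * e + p * e + q * d"
  proof -
    have "d = fps_exp 1 - p" "e = fps_exp (-1) - q"
      by (simp_all add: d_def e_def p_def q_def exp_tail_def fps_reflect_diff fps_reflect_fps_exp)
    then have "(d + p) * (e + q) = 1"
      using inverse[of 1] by simp
    then show ?thesis
      by (simp add: algebra_simps)
  qed
  have uv: "u * v = fps_const ((-1) ^ M / (fact N * fact M)) * fps_X ^ (M + N)"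
    by (simp add: u_def v_def power_add mult_ac flip: fps_const_mult)
  have "(d * e) * ?L = (1 - p * q) * ((d * bern_egf N x) * (e * fps_reflect (bern_egf M x)))"
    by (simp add: p_def q_def mult_ac)
  also have "\<dots> = (1 - p * q) * (u * v * (fps_exp x * fps_exp (- x)))"
    by (simp only: dN eM mult_ac)
  also have "\<dots> = (d * e + p * e + q * d) * (u * v)"
    by (simp add: inverse key)
  \<comment> \<open>At the argument \<open>0\<close> the exponential is \<open>1\<close>, so one factor \<open>u\<close> or \<open>v\<close> can be traded for a
    denominator times a generating function of Bernoulli numbers.\<close>
  also have "\<dots> = d * e * (u * v) + v * p * e * (d * bern_egf N 0)
      + u * q * d * (e * fps_reflect (bern_egf M 0))"
    unfolding dN eM by (simp add: algebra_simps)
  also have "\<dots> = (d * e) * ?R"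
    unfolding uv[symmetric] p_def[symmetric] q_def[symmetric] u_def[symmetric] v_def[symmetric]
    by (simp add: algebra_simps)
  finally show ?thesis
    using exp_tail_nonzero[OF assms(1), where 'a='a] exp_tail_nonzero[OF assms(2), where 'a='a]
    by (simp add: d_def e_def fps_reflect_eq_0_iff)
qed

text \<open>Since \<open>T\<^sub>N\<^sub>-\<^sub>1 - T\<^sub>M\<^sub>-\<^sub>1 = D\<^sub>M - D\<^sub>N\<close>, each term on the right is what remains when one of the two
  denominators cancels.\<close>

lemma bern_egf_product:
  fixes x y :: "'a::field_char_0"
  assumes "M > 0" "N > 0"
  shows "(taylor_fps N - taylor_fps M) * (bern_egf N x * bern_egf M y) =
    fps_const (1 / fact M) * fps_X ^ M * bern_egf N (x + y)
    - fps_const (1 / fact N) * fps_X ^ N * bern_egf M (x + y)" (is "?L = ?R")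
proof -
  define d e :: "'a fps" where "d = exp_tail N" and "e = exp_tail M"
  define u v :: "'a fps" where "u = fps_const (1 / fact N) * fps_X ^ N"
    and "v = fps_const (1 / fact M) * fps_X ^ M"
  have dN: "d * bern_egf N z = u * fps_exp z" for z
    unfolding d_def u_def by (rule exp_tail_times_bern_egf[OF assms(2)])
  have eM: "e * bern_egf M z = v * fps_exp z" for z
    unfolding e_def v_def by (rule exp_tail_times_bern_egf[OF assms(1)])
  have key: "taylor_fps N - taylor_fps M = e - d"
    by (simp add: d_def e_def exp_tail_def)
  have "(d * e) * ?L = (e - d) * ((d * bern_egf N x) * (e * bern_egf M y))"
    by (simp add: key mult_ac)
  also have "\<dots> = (e - d) * (u * v * fps_exp (x + y))"
    unfolding dN eM fps_exp_add_mult by (simp only: mult_ac)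
  also have "\<dots> = v * e * (d * bern_egf N (x + y)) - u * d * (e * bern_egf M (x + y))"
    unfolding dN eM by (simp add: algebra_simps)
  also have "\<dots> = (d * e) * ?R"
    unfolding u_def[symmetric] v_def[symmetric] by (simp add: algebra_simps)
  finally show ?thesis
    using exp_tail_nonzero[OF assms(1), where 'a='a] exp_tail_nonzero[OF assms(2), where 'a='a]
    by (simp add: d_def e_def)
qed

section \<open>Comparison of coefficients\<close>

lemma hyp_bernpoly_neg: "i < 0 \<Longrightarrow> hyp_bernpoly N i x = 0"
  by (simp add: hyp_bernpoly_def)

lemma fps_nth_shifted_product:
  fixes f g :: "'a::field_char_0 fps"
  shows "fps_nth (fps_const c * fps_X ^ m * (f * g)) n =
    c * (\<Sum>k | m + k \<le> n. fps_nth f (n - m - k) * fps_nth g k)"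
proof (cases "m \<le> n")
  case True
  then have "{k. m + k \<le> n} = {0..n - m}"
    by auto
  moreover have "fps_nth (f * g) (n - m) = (\<Sum>k=0..n-m. fps_nth f (n - m - k) * fps_nth g k)"
    by (subst mult.commute, subst fps_mult_nth) (simp add: mult.commute)
  ultimately show ?thesis
    using True by (simp add: fps_X_power_mult_nth mult.assoc)
next
  case False
  then show ?thesis
    by (simp add: fps_X_power_mult_nth mult.assoc)
qed

lemma fact_mult_nth_bern_egf_product:
  fixes x y :: "'a::field_char_0"
  shows "fact n * fps_nth (fps_const c * fps_X ^ m * (bern_egf N x * bern_egf M y)) n =
    fact m * c * (\<Sum>k | m + k \<le> n. multinom n m k *
      hyp_bernpoly N (int n - int m - int k) x * hyp_bernpoly M (int k) y)"
  unfolding fps_nth_shifted_product sum_distrib_left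
  by (intro sum.cong refl)
     (simp add: bern_egf_def multinom_def of_nat_diff diff_diff_eq mult_ac)

lemma fact_mult_nth_bern_egf_product_reflected:
  fixes x y :: "'a::field_char_0"
  shows "fact n * fps_nth (fps_const c * fps_X ^ m * (bern_egf N x * fps_reflect (bern_egf M y))) n =
    fact m * c * (\<Sum>k | m + k \<le> n. (-1) ^ k * multinom n m k *
      hyp_bernpoly N (int n - int m - int k) x * hyp_bernpoly M (int k) y)"
  unfolding fps_nth_shifted_product sum_distrib_left
  by (intro sum.cong refl)
     (simp add: fps_reflect_nth bern_egf_def multinom_def of_nat_diff diff_diff_eq mult_ac)

lemma fps_nth_two_shifts:
  fixes f :: "'a::field_char_0 fps"
  shows "fps_nth (fps_const c * fps_X ^ m * (fps_const d * fps_X ^ j * f)) n =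
    (if m + j \<le> n then c * d * fps_nth f (n - j - m) else 0)"
  by (auto simp: mult.assoc fps_X_power_mult_nth add.commute diff_right_commute)

text \<open>The convention that \<open>B\<close> vanishes at a negative index absorbs the case in which the shift
  exceeds \<open>n\<close>, where the truncated subtraction makes the multinomial coefficient meaningless.\<close>

lemma fact_mult_nth_taylor_bern_egf:
  "fact n * fps_nth (fps_const ((-1) ^ M / fact M) * fps_X ^ M * (taylor_fps N * bern_egf N 0)) n =
    (-1) ^ M * (\<Sum>m=0..N-1. multinom n m M * hyp_bernum N (int n - int m - int M))"
  unfolding taylor_fps_expansion sum_distrib_left sum_distrib_right fps_sum_nth fps_nth_two_shifts
  by (intro sum.cong refl)
     (auto simp: hyp_bernum_def hyp_bernpoly_neg bern_egf_def
      multinom_def of_nat_diff diff_diff_eq mult_ac)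

text \<open>The sign \<open>(-1)\<^sup>m\<close> of \<open>T\<^sub>M\<^sub>-\<^sub>1(-t)\<close> and the sign \<open>(-1)\<^bsup>n-m-N\<^esup>\<close> of the reflected generating function
  combine to one that is independent of the summation index.\<close>

lemma fact_mult_nth_taylor_bern_egf_reflected:
  "fact n * fps_nth (fps_const (1 / fact N) * fps_X ^ N *
      (fps_reflect (taylor_fps M) * fps_reflect (bern_egf M 0))) n =
    (-1) powi (int n - int N) * (\<Sum>m=0..M-1. multinom n m N * hyp_bernum M (int n - int m - int N))"
proof -
  have "fact n * fps_nth (fps_const (1 / fact N) * fps_X ^ N *
      (fps_const ((-1) ^ m / fact m) * fps_X ^ m * fps_reflect (bern_egf M 0))) n =
    (-1) powi (int n - int N) * (multinom n m N * hyp_bernum M (int n - int m - int N) :: 'a)" for m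
  proof (cases "N + m \<le> n")
    case True
    have "(-1 :: 'a) powi (int n - int N) = (-1) powi int (n - N)"
      using True by (simp add: of_nat_diff)
    also have "\<dots> = (-1) ^ (m + (n - m - N))"
      using True by (simp only: power_int_of_nat) (rule arg_cong, simp)
    also have "\<dots> = (-1) ^ m * (-1) ^ (n - m - N)"
      by (rule power_add)
    finally show ?thesis
      using True unfolding fps_nth_two_shifts
      by (simp add: fps_reflect_nth hyp_bernum_def bern_egf_def multinom_def
          of_nat_diff diff_diff_eq mult_ac)
  next
    case False
    then show ?thesis
      by (simp add: fps_nth_two_shifts hyp_bernum_def hyp_bernpoly_neg)
  qed
  then show ?thesis
    unfolding fps_reflect_taylor_fps_expansion sum_distrib_left sum_distrib_right fps_sum_nth
    by (intro sum.cong refl)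
qed

lemma fact_mult_nth_shifted_bern_egf:
  "fact n * fps_nth (fps_const (1 / fact m) * fps_X ^ m * bern_egf N x) n =
    of_nat (n choose m) * hyp_bernpoly N (int n - int m) x"
  by (simp add: mult.assoc fps_X_power_mult_nth bern_egf_def hyp_bernpoly_neg binomial_fact of_nat_diff)

lemma taylor_fps_diff_expansion:
  assumes "M \<le> N" "M > 0"
  shows "taylor_fps N - taylor_fps M = (\<Sum>m\<in>{M..<N}. fps_const (1 / fact m) * fps_X ^ m)"
proof -
  have "{0..N-1} = {0..M-1} \<union> {M..<N}" "{0..M-1} \<inter> {M..<N} = {}"
    using assms by auto
  then show ?thesis
    using assms by (simp add: taylor_fps_expansion sum.union_disjoint)
qed

theorem theorem15:
  fixes M N n :: nat
  assumes "M > 0" and "N > 0"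
  shows
    "(\<forall>x :: 'a::field_char_0.
       (\<Sum>m=1..M+N-2. fact m * taylor_prod_coeff M N m *
          (\<Sum>k | m + k \<le> n. (-1) ^ k * multinom n m k *
             hyp_bernpoly N (int n - int m - int k) x * hyp_bernpoly M (int k) x))
       = (-1) ^ M * of_nat ((M + N) choose M) * delta (int n - int M - int N)
         + (-1) ^ M * (\<Sum>m=0..N-1. multinom n m M * hyp_bernum N (int n - int m - int M))
         + (-1) powi (int n - int N) *
             (\<Sum>m=0..M-1. multinom n m N * hyp_bernum M (int n - int m - int N)))
     \<and> (M \<le> N \<longrightarrow>
         (\<forall>x1 x2 x :: 'a. x = x1 + x2 \<longrightarrow>
            (\<Sum>m\<in>{M..<N}. \<Sum>k | m + k \<le> n. multinom n m k *
               hyp_bernpoly N (int n - int m - int k) x1 * hyp_bernpoly M (int k) x2)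
            = of_nat (n choose M) * hyp_bernpoly N (int n - int M) x
              - of_nat (n choose N) * hyp_bernpoly M (int n - int N) x))"
proof (intro conjI allI impI)
  fix x :: 'a
  have "(\<Sum>m=1..M+N-2. fact m * taylor_prod_coeff M N m *
          (\<Sum>k | m + k \<le> n. (-1) ^ k * multinom n m k *
             hyp_bernpoly N (int n - int m - int k) x * hyp_bernpoly M (int k) x)) =
      fact n * fps_nth ((1 - taylor_fps N * fps_reflect (taylor_fps M)) *
        (bern_egf N x * fps_reflect (bern_egf M x))) n"
    unfolding taylor_product_expansion_fps[OF assms] sum_distrib_right fps_sum_nth
      sum_distrib_left[of "fact n"] fact_mult_nth_bern_egf_product_reflected ..
  also have "\<dots> = fact n * fps_nth (fps_const ((-1) ^ M / (fact N * fact M)) * fps_X ^ (M + N)) n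
        + (-1) ^ M * (\<Sum>m=0..N-1. multinom n m M * hyp_bernum N (int n - int m - int M))
        + (-1) powi (int n - int N) *
            (\<Sum>m=0..M-1. multinom n m N * hyp_bernum M (int n - int m - int N))"
    unfolding bern_egf_product_reflected[OF assms] fps_add_nth distrib_left
      fact_mult_nth_taylor_bern_egf fact_mult_nth_taylor_bern_egf_reflected ..
  also have "fact n * fps_nth (fps_const ((-1) ^ M / (fact N * fact M)) * fps_X ^ (M + N)) n =
      (-1) ^ M * of_nat ((M + N) choose M) * (delta (int n - int M - int N) :: 'a)"
  proof -
    have "int n - int M - int N = 0 \<longleftrightarrow> n = M + N"
      by linarith
    then show ?thesis
      by (simp add: delta_def binomial_fact mult_ac)
  qed
  finally show "(\<Sum>m=1..M+N-2. fact m * taylor_prod_coeff M N m *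
          (\<Sum>k | m + k \<le> n. (-1) ^ k * multinom n m k *
             hyp_bernpoly N (int n - int m - int k) x * hyp_bernpoly M (int k) x))
       = (-1) ^ M * of_nat ((M + N) choose M) * delta (int n - int M - int N)
         + (-1) ^ M * (\<Sum>m=0..N-1. multinom n m M * hyp_bernum N (int n - int m - int M))
         + (-1) powi (int n - int N) *
             (\<Sum>m=0..M-1. multinom n m N * hyp_bernum M (int n - int m - int N))" .
next
  fix x1 x2 x :: 'a
  assume "M \<le> N" and x: "x = x1 + x2"
  have "(\<Sum>m\<in>{M..<N}. \<Sum>k | m + k \<le> n. multinom n m k *
            hyp_bernpoly N (int n - int m - int k) x1 * hyp_bernpoly M (int k) x2) =
      fact n * fps_nth ((taylor_fps N - taylor_fps M) * (bern_egf N x1 * bern_egf M x2)) n"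
    unfolding taylor_fps_diff_expansion[OF \<open>M \<le> N\<close> assms(1)] sum_distrib_right fps_sum_nth
      sum_distrib_left[of "fact n"] fact_mult_nth_bern_egf_product by simp
  also have "\<dots> = of_nat (n choose M) * hyp_bernpoly N (int n - int M) x
              - of_nat (n choose N) * hyp_bernpoly M (int n - int N) x"
    unfolding bern_egf_product[OF assms] fps_sub_nth right_diff_distrib
      fact_mult_nth_shifted_bern_egf x ..
  finally show "(\<Sum>m\<in>{M..<N}. \<Sum>k | m + k \<le> n. multinom n m k *
               hyp_bernpoly N (int n - int m - int k) x1 * hyp_bernpoly M (int k) x2)
            = of_nat (n choose M) * hyp_bernpoly N (int n - int M) x
              - of_nat (n choose N) * hyp_bernpoly M (int n - int N) x" .
qed

end
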